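(* Any maximal strongly regular space-like surface $\mathcal M:\ \mathbf z=\mathbf z(x,y)=(z_1,z_2,z_3)$, $(x,y)\in\mathcal D\subset\mathbb L$, in $\mathbb R^3_1$ (in the sense of the context), parameterized with canonical principal parameters, has locally a representation of the type $$(z_1)_x+j(z_1)_y=-\frac{w}{w'},\qquad (z_2)_x+j(z_2)_y=\frac12\,\frac{w^2-1}{w'},\qquad (z_3)_x+j(z_3)_y=\frac j2\,\frac{w^2+1}{w'},$$ where $w=u(x,y)+jv(x,y)$ is a holomorphic function in $\mathbb L$ satisfying the conditions $$u^2-v^2+1\neq0,\qquad \mu>0,\qquad \mu_x\mu_y\neq0,\qquad\text{where }\ \mu:=\frac{u_x^2-u_y^2}{(u^2-v^2+1)^2}.$$
   Context: $\mathbb R^3_1$ is the three-dimensional Minkowski space, i.e. $\mathbb R^3$ with the inner product $\langle a,b\rangle=a_1b_1+a_2b_2-a_3b_3$, and $a^2:=\langle a,a\rangle$. Subscripts $x,y$ denote partial derivatives. $\mathbb L=\{x+jy:\ x,y\in\mathbb R\}$, $j^2=1$, is the Lorentz plane, identified with the parameter plane. A function $w=u+jv$ is holomorphic in $\mathbb L$ if $\frac12(\partial_x-j\partial_y)w=0$, i.e. $u_x=v_y$, $u_y=v_x$; its derivative is $w'=\frac12(\partial_x+j\partial_y)w=u_x+ju_y$. A space-like surface here (the name refers to the causal character of its normal) is a surface $\mathbf z=\mathbf z(x,y)$, $(x,y)\in\mathcal D$, in $\mathbb R^3_1$ with $E=\mathbf z_x^2>0$, $G=\mathbf z_y^2<0$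 and unit normal $l$ with $l^2=1$. Put $F=\langle\mathbf z_x,\mathbf z_y\rangle$, $e=\langle\mathbf z_{xx},l\rangle$, $f=\langle\mathbf z_{xy},l\rangle$, $g=\langle\mathbf z_{yy},l\rangle$. Surfaces are supposed to have no umbilical points and to be parameterized by principal parameters, i.e. $F=f=0$ on $\mathcal D$. Put $X=\mathbf z_x/\sqrt E$, $Y=\mathbf z_y/\sqrt{-G}$; the principal curvatures and principal geodesic curvatures are $$\nu_1=\frac eE,\quad \nu_2=\frac gG,\quad \gamma_1=\frac{E_y}{2E\sqrt{-G}},\quad \gamma_2=-\frac{G_x}{2\sqrt E\,G}.$$ It is supposed that the frame $XYl$ is positively oriented and that $\nu_1-\nu_2>0$. The surface is strongly regular if $\gamma_1\gamma_2\neq0$ on $\mathcal D$, and maximal if $\nu_1+\nu_2=0$. For a maximal surface, $\nu:=\nu_1>0$ is the normal curvature function. Principal parameters $(x,y)$ of a maximal strongly regular surface are called canonical if $\mathbf z_x^2=-\mathbf z_y^2=1/\nu$.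
   Formalization: Near points where the unit normal l is (1,0,0) no such w exists, so the representation is stated near each point with first component l_1 ≠ 1; these points are shown to be dense in the domain, and at every point the representation holds after a suitable rotation of Minkowski space. *)

theory Defs
  imports "HOL-Analysis.Analysis"
begin

section \<open>The Lorentz plane as a ring\<close>

text \<open>Values in the Lorentz plane are elements of the ring \<open>lorentz\<close> of numbers \<open>u + j v\<close>,
  \<open>j\<^sup>2 = 1\<close>. As a parameter plane, i.e. as a space in which open sets and partial derivatives
  are taken, the Lorentz plane is identified with \<open>real \<times> real\<close>.\<close>

datatype lorentz = Lor (lre: real) (lim: real)

definition jj :: lorentz where "jj = Lor 0 1"

instantiation lorentz :: "{comm_ring_1, real_algebra_1, inverse}"
begin

definition zero_lorentz :: lorentz where "0 = Lor 0 0"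
definition one_lorentz :: lorentz where "1 = Lor 1 0"
definition plus_lorentz :: "lorentz \<Rightarrow> lorentz \<Rightarrow> lorentz" where
  "a + b = Lor (lre a + lre b) (lim a + lim b)"
definition uminus_lorentz :: "lorentz \<Rightarrow> lorentz" where
  "- a = Lor (- lre a) (- lim a)"
definition minus_lorentz :: "lorentz \<Rightarrow> lorentz \<Rightarrow> lorentz" where
  "a - b = Lor (lre a - lre b) (lim a - lim b)"
definition times_lorentz :: "lorentz \<Rightarrow> lorentz \<Rightarrow> lorentz" where
  "a * b = Lor (lre a * lre b + lim a * lim b) (lre a * lim b + lim a * lre b)"
definition scaleR_lorentz :: "real \<Rightarrow> lorentz \<Rightarrow> lorentz" where
  "r *\<^sub>R a = Lor (r * lre a) (r * lim a)"

text \<open>The inverse is genuine exactly off the null cone \<open>(lre a)\<^sup>2 = (lim a)\<^sup>2\<close>, whose elements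
  are zero or zero divisors; there it is set to \<open>0\<close>.\<close>
definition inverse_lorentz :: "lorentz \<Rightarrow> lorentz" where
  "inverse a = Lor (lre a / ((lre a)\<^sup>2 - (lim a)\<^sup>2)) (- lim a / ((lre a)\<^sup>2 - (lim a)\<^sup>2))"
definition divide_lorentz :: "lorentz \<Rightarrow> lorentz \<Rightarrow> lorentz" where
  "a div b = a * inverse (b :: lorentz)"

instance
  by standard
    (simp_all add: zero_lorentz_def one_lorentz_def plus_lorentz_def uminus_lorentz_def
      minus_lorentz_def times_lorentz_def scaleR_lorentz_def algebra_simps)

end

lemma jj_mult_jj: "jj * jj = 1"
  by (simp add: jj_def one_lorentz_def times_lorentz_def)

lemma of_real_lorentz: "(of_real r :: lorentz) = Lor r 0"
  by (simp add: of_real_def one_lorentz_def scaleR_lorentz_def)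

lemma Lor_eq: "Lor u v = of_real u + jj * of_real v"
  by (simp add: of_real_lorentz jj_def times_lorentz_def plus_lorentz_def)

lemma lorentz_right_inverse:
  assumes "(lre a)\<^sup>2 - (lim a)\<^sup>2 \<noteq> 0"
  shows "a * inverse a = 1"
proof -
  have "lre a * lre a - lim a * lim a \<noteq> 0"
    using assms by (simp add: power2_eq_square)
  then show ?thesis
    by (simp add: times_lorentz_def inverse_lorentz_def one_lorentz_def power2_eq_square
        diff_divide_distrib [symmetric])
qed

section \<open>Partial derivatives and smoothness\<close>

definition pdx :: "(real \<times> real \<Rightarrow> 'a::real_normed_vector) \<Rightarrow> real \<times> real \<Rightarrow> 'a" where
  "pdx f p = vector_derivative (\<lambda>t. f (t, snd p)) (at (fst p))"

definition pdy :: "(real \<times> real \<Rightarrow> 'a::real_normed_vector) \<Rightarrow> real \<times> real \<Rightarrow> 'a" where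
  "pdy f p = vector_derivative (\<lambda>t. f (fst p, t)) (at (snd p))"

text \<open>All iterated partial derivatives up to order \<open>k\<close> exist on \<open>U\<close>; those of order \<open>k\<close> are
  continuous. On an open set \<open>U\<close> this is the usual notion of class \<open>C\<^sup>k\<close>.\<close>
primrec Ck_on :: "nat \<Rightarrow> (real \<times> real) set \<Rightarrow> (real \<times> real \<Rightarrow> 'a::real_normed_vector) \<Rightarrow> bool" where
  "Ck_on 0 U f \<longleftrightarrow> continuous_on U f"
| "Ck_on (Suc k) U f \<longleftrightarrow>
     (\<forall>p\<in>U. (\<lambda>t. f (t, snd p)) differentiable at (fst p) \<and>
            (\<lambda>t. f (fst p, t)) differentiable at (snd p)) \<and>
     Ck_on k U (pdx f) \<and> Ck_on k U (pdy f)"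

definition smooth_fun_on :: "(real \<times> real) set \<Rightarrow> (real \<times> real \<Rightarrow> 'a::real_normed_vector) \<Rightarrow> bool" where
  "smooth_fun_on U f \<longleftrightarrow> (\<forall>k. Ck_on k U f)"

section \<open>Holomorphic functions in the Lorentz plane\<close>

definition lpdx :: "(real \<times> real \<Rightarrow> lorentz) \<Rightarrow> real \<times> real \<Rightarrow> lorentz" where
  "lpdx w p = Lor (pdx (\<lambda>q. lre (w q)) p) (pdx (\<lambda>q. lim (w q)) p)"

definition lpdy :: "(real \<times> real \<Rightarrow> lorentz) \<Rightarrow> real \<times> real \<Rightarrow> lorentz" where
  "lpdy w p = Lor (pdy (\<lambda>q. lre (w q)) p) (pdy (\<lambda>q. lim (w q)) p)"

definition lderiv :: "(real \<times> real \<Rightarrow> lorentz) \<Rightarrow> real \<times> real \<Rightarrow> lorentz" where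
  "lderiv w p = (1/2) *\<^sub>R (lpdx w p + jj * lpdy w p)"

text \<open>Unlike over the complex numbers, smoothness does not follow from the differential equation
  and is therefore required explicitly.\<close>
definition lorentz_holomorphic_on :: "(real \<times> real \<Rightarrow> lorentz) \<Rightarrow> (real \<times> real) set \<Rightarrow> bool" where
  "lorentz_holomorphic_on w U \<longleftrightarrow>
     smooth_fun_on U (\<lambda>q. lre (w q)) \<and> smooth_fun_on U (\<lambda>q. lim (w q)) \<and>
     (\<forall>p\<in>U. (1/2) *\<^sub>R (lpdx w p - jj * lpdy w p) = 0)"

lemma lorentz_Cauchy_Riemann:
  "(1/2) *\<^sub>R (lpdx w p - jj * lpdy w p) = 0 \<longleftrightarrow>
     pdx (\<lambda>q. lre (w q)) p = pdy (\<lambda>q. lim (w q)) p \<and>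
     pdy (\<lambda>q. lre (w q)) p = pdx (\<lambda>q. lim (w q)) p"
  by (auto simp: lpdx_def lpdy_def jj_def zero_lorentz_def minus_lorentz_def times_lorentz_def
      scaleR_lorentz_def)

section \<open>Surfaces in Minkowski space\<close>

definition mink :: "real^3 \<Rightarrow> real^3 \<Rightarrow> real" where
  "mink a b = a$1 * b$1 + a$2 * b$2 - a$3 * b$3"

type_synonym surf = "real \<times> real \<Rightarrow> real^3"

definition coefE :: "surf \<Rightarrow> real \<times> real \<Rightarrow> real" where
  "coefE z p = mink (pdx z p) (pdx z p)"
definition coefF :: "surf \<Rightarrow> real \<times> real \<Rightarrow> real" where
  "coefF z p = mink (pdx z p) (pdy z p)"
definition coefG :: "surf \<Rightarrow> real \<times> real \<Rightarrow> real" where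
  "coefG z p = mink (pdy z p) (pdy z p)"

definition coefe :: "surf \<Rightarrow> surf \<Rightarrow> real \<times> real \<Rightarrow> real" where
  "coefe z l p = mink (pdx (pdx z) p) (l p)"
definition coeff :: "surf \<Rightarrow> surf \<Rightarrow> real \<times> real \<Rightarrow> real" where
  "coeff z l p = mink (pdy (pdx z) p) (l p)"
definition coefg :: "surf \<Rightarrow> surf \<Rightarrow> real \<times> real \<Rightarrow> real" where
  "coefg z l p = mink (pdy (pdy z) p) (l p)"

definition frameX :: "surf \<Rightarrow> real \<times> real \<Rightarrow> real^3" where
  "frameX z p = (1 / sqrt (coefE z p)) *\<^sub>R pdx z p"
definition frameY :: "surf \<Rightarrow> real \<times> real \<Rightarrow> real^3" where
  "frameY z p = (1 / sqrt (- coefG z p)) *\<^sub>R pdy z p"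

definition nu1 :: "surf \<Rightarrow> surf \<Rightarrow> real \<times> real \<Rightarrow> real" where
  "nu1 z l p = coefe z l p / coefE z p"
definition nu2 :: "surf \<Rightarrow> surf \<Rightarrow> real \<times> real \<Rightarrow> real" where
  "nu2 z l p = coefg z l p / coefG z p"
definition gamma1 :: "surf \<Rightarrow> real \<times> real \<Rightarrow> real" where
  "gamma1 z p = pdy (coefE z) p / (2 * coefE z p * sqrt (- coefG z p))"
definition gamma2 :: "surf \<Rightarrow> real \<times> real \<Rightarrow> real" where
  "gamma2 z p = - pdx (coefG z) p / (2 * sqrt (coefE z p) * coefG z p)"

text \<open>A space-like surface \<open>z\<close> on \<open>D\<close> with unit normal \<open>l\<close>, in principal parameters. The
  orientation is the standard one of the coordinate space; it makes \<open>l\<close> unique. The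
  condition \<open>nu1 > nu2\<close> excludes umbilical points.\<close>
definition spacelike_principal_surface :: "(real \<times> real) set \<Rightarrow> surf \<Rightarrow> surf \<Rightarrow> bool" where
  "spacelike_principal_surface D z l \<longleftrightarrow>
     open D \<and> smooth_fun_on D z \<and>
     (\<forall>p\<in>D. coefE z p > 0 \<and> coefG z p < 0 \<and>
        mink (pdx z p) (l p) = 0 \<and> mink (pdy z p) (l p) = 0 \<and> mink (l p) (l p) = 1 \<and>
        coefF z p = 0 \<and> coeff z l p = 0 \<and>
        det (vector [frameX z p, frameY z p, l p] :: real^3^3) > 0 \<and>
        nu1 z l p - nu2 z l p > 0)"

definition strongly_regular_on :: "(real \<times> real) set \<Rightarrow> surf \<Rightarrow> bool" where
  "strongly_regular_on D z \<longleftrightarrow> (\<forall>p\<in>D. gamma1 z p * gamma2 z p \<noteq> 0)"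

definition maximal_on :: "(real \<times> real) set \<Rightarrow> surf \<Rightarrow> surf \<Rightarrow> bool" where
  "maximal_on D z l \<longleftrightarrow> (\<forall>p\<in>D. nu1 z l p + nu2 z l p = 0)"

definition canonical_parameters_on :: "(real \<times> real) set \<Rightarrow> surf \<Rightarrow> surf \<Rightarrow> bool" where
  "canonical_parameters_on D z l \<longleftrightarrow>
     (\<forall>p\<in>D. coefE z p = 1 / nu1 z l p \<and> - coefG z p = 1 / nu1 z l p)"

section \<open>The Weierstrass type representation\<close>

definition mu :: "(real \<times> real \<Rightarrow> lorentz) \<Rightarrow> real \<times> real \<Rightarrow> real" where
  "mu w p = ((pdx (\<lambda>q. lre (w q)) p)\<^sup>2 - (pdy (\<lambda>q. lre (w q)) p)\<^sup>2) /
            ((lre (w p))\<^sup>2 - (lim (w p))\<^sup>2 + 1)\<^sup>2"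

definition admissible_on :: "(real \<times> real) set \<Rightarrow> (real \<times> real \<Rightarrow> lorentz) \<Rightarrow> bool" where
  "admissible_on U w \<longleftrightarrow>
     (\<forall>p\<in>U. (lre (w p))\<^sup>2 - (lim (w p))\<^sup>2 + 1 \<noteq> 0 \<and> mu w p > 0 \<and>
            pdx (mu w) p * pdy (mu w) p \<noteq> 0)"

definition lgrad :: "(real \<times> real \<Rightarrow> real) \<Rightarrow> real \<times> real \<Rightarrow> lorentz" where
  "lgrad h p = of_real (pdx h p) + jj * of_real (pdy h p)"

text \<open>Where \<open>mu w > 0\<close> and \<open>w\<close> is holomorphic, \<open>lderiv w\<close> is invertible, so the quotients below
  are genuine.\<close>
definition represented_by :: "(real \<times> real) set \<Rightarrow> surf \<Rightarrow> (real \<times> real \<Rightarrow> lorentz) \<Rightarrow> bool" where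
  "represented_by U z w \<longleftrightarrow>
     (\<forall>p\<in>U. lgrad (\<lambda>q. z q $ 1) p = - (w p / lderiv w p) \<and>
            lgrad (\<lambda>q. z q $ 2) p = (1/2) *\<^sub>R (((w p)\<^sup>2 - 1) / lderiv w p) \<and>
            lgrad (\<lambda>q. z q $ 3) p = (1/2) *\<^sub>R (jj * (((w p)\<^sup>2 + 1) / lderiv w p)))"

text \<open>The function \<open>w\<close> is forced by the representation: \<open>w = (l$2 + j l$3) / (1 - l$1)\<close>, the
  stereographic projection of the unit normal \<open>l\<close> from \<open>(1, 0, 0)\<close>. Hence a surface has no
  representation near a point with \<open>l$1 = 1\<close>, and must first be moved by a rotation there.\<close>
definition representable_near :: "(real \<times> real) set \<Rightarrow> surf \<Rightarrow> real \<times> real \<Rightarrow> bool" where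
  "representable_near D z p \<longleftrightarrow>
     (\<exists>U w. open U \<and> p \<in> U \<and> U \<subseteq> D \<and>
        lorentz_holomorphic_on w U \<and> admissible_on U w \<and> represented_by U z w)"

definition minkowski_rotation :: "(real^3 \<Rightarrow> real^3) \<Rightarrow> bool" where
  "minkowski_rotation A \<longleftrightarrow>
     linear A \<and> (\<forall>a b. mink (A a) (A b) = mink a b) \<and> det (matrix A) = 1"

end

theory Submission
  imports Defs
begin

text \<open>
  In canonical parameters \<open>e = g = 1\<close> and \<open>f = 0\<close>, so the Weingarten equations read
  \<open>l\<^sub>x = - z\<^sub>x / E\<close> and \<open>l\<^sub>y = z\<^sub>y / E\<close>: the Gauss map is conformal. The stereographic projection
  \<open>w = (l\<^sub>2 + j l\<^sub>3) / (1 - l\<^sub>1)\<close> is conformal as well, and the cross product relations of the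
  frame give the Cauchy--Riemann equations for \<open>w\<close>, with
  \<open>w' = ((y\<^sub>3 - x\<^sub>2) + j (y\<^sub>2 - x\<^sub>3)) / (E (1 - l\<^sub>1)\<^sup>2)\<close> for \<open>x = z\<^sub>x\<close>, \<open>y = z\<^sub>y\<close>. Multiplying
  \<open>x\<^sub>i + j y\<^sub>i\<close> by \<open>w'\<close> and using the completeness relation of the frame yields the
  representation, and \<open>mu = 1 / (4 E)\<close> turns strong regularity into the condition on \<open>mu\<close>.
  If \<open>l\<^sub>1\<close> were constantly \<open>1\<close> near a point, the Weingarten equations would successively make all
  components of \<open>z\<^sub>x\<close> vanish there. At the points where \<open>l\<^sub>1 = 1\<close> a half turn makes \<open>l\<^sub>1 = -1\<close>.
\<close>

section \<open>Partial derivatives\<close>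

text \<open>A relation carrying existence and value together lets the derivative rules compose
  without separate differentiability side conditions, which \<open>pdx\<close> and
  \<open>pdy\<close>, built on a choice of derivative, would require. Only the two partial
  derivatives are asserted, not a total derivative.\<close>

definition has_pds ::
  "(real \<times> real \<Rightarrow> 'a::real_normed_vector) \<Rightarrow> 'a \<Rightarrow> 'a \<Rightarrow> real \<times> real \<Rightarrow> bool" where
  "has_pds f a b p \<longleftrightarrow>
     ((\<lambda>t. f (t, snd p)) has_vector_derivative a) (at (fst p)) \<and>
     ((\<lambda>t. f (fst p, t)) has_vector_derivative b) (at (snd p))"

lemma has_pds_imp_eq:
  assumes "has_pds f a b p"
  shows "pdx f p = a" "pdy f p = b"
  using assms by (auto simp: has_pds_def pdx_def pdy_def vector_derivative_at)

lemma open_axis_sections: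
  fixes U :: "(real \<times> real) set"
  assumes "open U"
  shows "open {t. (t, y) \<in> U}" "open {t. (x, t) \<in> U}"
proof -
  have "open ((\<lambda>t. (t, y)) -` U)" "open ((\<lambda>t. (x, t)) -` U)"
    by (intro open_vimage assms continuous_intros)+
  then show "open {t. (t, y) \<in> U}" "open {t. (x, t) \<in> U}"
    by (auto simp: vimage_def)
qed

text \<open>Agreement on an open set restricts to agreement on open sections along both axes, and
  each one-variable derivative depends only on its section.\<close>

lemma has_pds_transform:
  assumes "has_pds f a b p" "open U" "p \<in> U" "\<And>q. q \<in> U \<Longrightarrow> f q = g q"
  shows "has_pds g a b p"
  unfolding has_pds_def
proof
  show "((\<lambda>t. g (t, snd p)) has_vector_derivative a) (at (fst p))"
    by (rule has_vector_derivative_transform_within_open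
        [where f = "\<lambda>t. f (t, snd p)", OF _ open_axis_sections(1)[OF assms(2), of "snd p"]])
      (use assms in \<open>auto simp: has_pds_def\<close>)
  show "((\<lambda>t. g (fst p, t)) has_vector_derivative b) (at (snd p))"
    by (rule has_vector_derivative_transform_within_open
        [where f = "\<lambda>t. f (fst p, t)", OF _ open_axis_sections(2)[OF assms(2), of "fst p"]])
      (use assms in \<open>auto simp: has_pds_def\<close>)
qed

lemma has_pds_const: "has_pds (\<lambda>q. c) 0 0 p"
  by (simp add: has_pds_def)

lemma has_pds_add:
  assumes "has_pds f a b p" "has_pds g c d p"
  shows "has_pds (\<lambda>q. f q + g q) (a + c) (b + d) p"
  using assms by (auto simp: has_pds_def intro!: has_vector_derivative_add)

lemma has_pds_diff:
  assumes "has_pds f a b p" "has_pds g c d p"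
  shows "has_pds (\<lambda>q. f q - g q) (a - c) (b - d) p"
  using assms by (auto simp: has_pds_def intro!: has_vector_derivative_diff)

lemma has_pds_linear:
  assumes "bounded_linear A" "has_pds f a b p"
  shows "has_pds (\<lambda>q. A (f q)) (A a) (A b) p"
  using assms(2) bounded_linear.has_vector_derivative[OF assms(1)] by (simp add: has_pds_def)

lemma has_pds_bilinear:
  assumes "bounded_bilinear B" "has_pds f a b p" "has_pds g c d p"
  shows "has_pds (\<lambda>q. B (f q) (g q)) (B (f p) c + B a (g p)) (B (f p) d + B b (g p)) p"
  using assms(2,3)
    bounded_bilinear.has_vector_derivative
      [OF assms(1), of "\<lambda>t. f (t, snd p)" a "fst p" UNIV "\<lambda>t. g (t, snd p)" c]
    bounded_bilinear.has_vector_derivative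
      [OF assms(1), of "\<lambda>t. f (fst p, t)" b "snd p" UNIV "\<lambda>t. g (fst p, t)" d]
  by (simp add: has_pds_def)

lemma has_pds_divide:
  fixes f g :: "real \<times> real \<Rightarrow> real"
  assumes "has_pds f a b p" "has_pds g c d p" "g p \<noteq> 0"
  shows "has_pds (\<lambda>q. f q / g q)
    ((a * g p - f p * c) / (g p * g p)) ((b * g p - f p * d) / (g p * g p)) p"
  using assms
    DERIV_divide[of "\<lambda>t. f (t, snd p)" a "fst p" UNIV "\<lambda>t. g (t, snd p)" c]
    DERIV_divide[of "\<lambda>t. f (fst p, t)" b "snd p" UNIV "\<lambda>t. g (fst p, t)" d]
  by (auto simp: has_pds_def has_real_derivative_iff_has_vector_derivative)

section \<open>Smoothness classes and their closure properties\<close>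

lemma Ck_on_Suc_has_pds:
  "Ck_on (Suc k) U f \<Longrightarrow> p \<in> U \<Longrightarrow> has_pds f (pdx f p) (pdy f p) p"
  by (auto simp: has_pds_def pdx_def pdy_def vector_derivative_works[symmetric])

text \<open>The recursion of \<open>Ck_on\<close> runs through \<open>pdx f\<close> as a function on
  the whole plane, while formulas for it are known on \<open>U\<close> only. Openness carries the
  agreement on \<open>U\<close> over to the partial derivatives, hence through the
  induction.\<close>

lemma Ck_on_transform:
  assumes "open U"
  shows "Ck_on k U f \<Longrightarrow> (\<And>p. p \<in> U \<Longrightarrow> f p = g p) \<Longrightarrow> Ck_on k U g"
proof (induction k arbitrary: f g)
  case 0
  then show ?case using continuous_on_cong[OF refl, of U f g] by simp
next
  case (Suc k)
  have pds: "has_pds g (pdx f p) (pdy f p) p" if "p \<in> U" for p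
    by (rule has_pds_transform[OF Ck_on_Suc_has_pds[OF Suc.prems(1) that] assms that Suc.prems(2)])
  have "Ck_on k U (pdx g)" "Ck_on k U (pdy g)"
    using Suc.prems(1)
    by (auto intro: Suc.IH[of "pdx f"] Suc.IH[of "pdy f"] simp: has_pds_imp_eq[OF pds])
  then show ?case
    using pds by (auto simp: has_pds_def intro: differentiableI_vector)
qed

text \<open>Allows explicit formulas \<open>a\<close> and \<open>b\<close> to stand in for
  \<open>pdx f\<close> and \<open>pdy f\<close>, as the sum, product and quotient rules deliver
  them.\<close>

lemma Ck_on_Suc_intro:
  assumes "open U" "\<And>p. p \<in> U \<Longrightarrow> has_pds f (a p) (b p) p" "Ck_on k U a" "Ck_on k U b"
  shows "Ck_on (Suc k) U f"
proof -
  have "Ck_on k U (pdx f)" "Ck_on k U (pdy f)"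
    by (rule Ck_on_transform[OF assms(1,3)] Ck_on_transform[OF assms(1,4)],
        simp add: has_pds_imp_eq[OF assms(2)])+
  then show ?thesis
    using assms(2) by (auto simp: has_pds_def intro: differentiableI_vector)
qed

lemma smooth_fun_on_has_pds:
  "smooth_fun_on U f \<Longrightarrow> p \<in> U \<Longrightarrow> has_pds f (pdx f p) (pdy f p) p"
  unfolding smooth_fun_on_def using Ck_on_Suc_has_pds by blast

lemma smooth_fun_on_pd:
  assumes "smooth_fun_on U f"
  shows "smooth_fun_on U (pdx f)" "smooth_fun_on U (pdy f)"
  using assms unfolding smooth_fun_on_def by (metis Ck_on.simps(2))+

lemma smooth_fun_on_imp_continuous_on: "smooth_fun_on U f \<Longrightarrow> continuous_on U f"
  unfolding smooth_fun_on_def by (metis Ck_on.simps(1))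

lemma smooth_fun_on_transform:
  assumes "open U" "smooth_fun_on U f" "\<And>p. p \<in> U \<Longrightarrow> f p = g p"
  shows "smooth_fun_on U g"
  unfolding smooth_fun_on_def
proof
  fix k
  show "Ck_on k U g"
    by (rule Ck_on_transform[OF assms(1) _ assms(3)]) (use assms(2) in \<open>simp_all add: smooth_fun_on_def\<close>)
qed

lemma Ck_on_subset:
  assumes "V \<subseteq> U"
  shows "Ck_on k U f \<Longrightarrow> Ck_on k V f"
proof (induction k arbitrary: f)
  case 0
  then show ?case using continuous_on_subset[OF _ assms] by simp
next
  case (Suc k)
  then show ?case using assms by (auto simp: subset_iff)
qed

lemma smooth_fun_on_subset: "smooth_fun_on U f \<Longrightarrow> V \<subseteq> U \<Longrightarrow> smooth_fun_on V f"
  unfolding smooth_fun_on_def by (blast intro: Ck_on_subset)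

lemma Ck_on_const:
  assumes "open U"
  shows "Ck_on k U (\<lambda>q. c)"
proof (induction k arbitrary: c)
  case (Suc k)
  show ?case by (rule Ck_on_Suc_intro[OF assms has_pds_const Suc Suc])
qed simp

lemma Ck_on_add:
  assumes "open U"
  shows "Ck_on k U f \<Longrightarrow> Ck_on k U g \<Longrightarrow> Ck_on k U (\<lambda>q. f q + g q)"
proof (induction k arbitrary: f g)
  case 0
  then show ?case by (auto intro: continuous_on_add)
next
  case (Suc k)
  show ?case
  proof (rule Ck_on_Suc_intro[OF assms])
    show "has_pds (\<lambda>q. f q + g q) (pdx f p + pdx g p) (pdy f p + pdy g p) p" if "p \<in> U" for p
      by (rule has_pds_add[OF Ck_on_Suc_has_pds[OF Suc.prems(1) that]
            Ck_on_Suc_has_pds[OF Suc.prems(2) that]])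
  qed (use Suc in auto)
qed

lemma Ck_on_linear:
  assumes "open U" "bounded_linear A"
  shows "Ck_on k U f \<Longrightarrow> Ck_on k U (\<lambda>q. A (f q))"
proof (induction k arbitrary: f)
  case 0
  then show ?case using bounded_linear.continuous_on[OF assms(2)] by simp
next
  case (Suc k)
  show ?case
  proof (rule Ck_on_Suc_intro[OF assms(1)])
    show "has_pds (\<lambda>q. A (f q)) (A (pdx f p)) (A (pdy f p)) p" if "p \<in> U" for p
      by (rule has_pds_linear[OF assms(2) Ck_on_Suc_has_pds[OF Suc.prems that]])
  qed (use Suc in auto)
qed

lemma Ck_on_diff:
  assumes "open U" "Ck_on k U f" "Ck_on k U g"
  shows "Ck_on k U (\<lambda>q. f q - g q)"
  using Ck_on_add[OF assms(1,2) Ck_on_linear[OF assms(1) bounded_linear_minus[OF bounded_linear_ident] assms(3)]]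
  by simp

lemma smooth_fun_on_linear:
  assumes "open U" "bounded_linear A" "smooth_fun_on U f"
  shows "smooth_fun_on U (\<lambda>q. A (f q))"
  using assms unfolding smooth_fun_on_def by (blast intro: Ck_on_linear)

lemma smooth_fun_on_const: "open U \<Longrightarrow> smooth_fun_on U (\<lambda>q. c)"
  unfolding smooth_fun_on_def by (blast intro: Ck_on_const)

lemma smooth_fun_on_diff:
  "open U \<Longrightarrow> smooth_fun_on U f \<Longrightarrow> smooth_fun_on U g \<Longrightarrow> smooth_fun_on U (\<lambda>q. f q - g q)"
  unfolding smooth_fun_on_def by (blast intro: Ck_on_diff)

text \<open>One Leibniz rule serves real products, scalar multiples, \<open>mink\<close> and
  \<open>mcross\<close>.\<close>

lemma smooth_fun_on_bilinear:
  assumes "bounded_bilinear B" "open U" "smooth_fun_on U f" "smooth_fun_on U g"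
  shows "smooth_fun_on U (\<lambda>q. B (f q) (g q))"
proof -
  \<comment> \<open>The factors stay fully smooth during the induction on \<open>k\<close>. The
    Leibniz terms contain undifferentiated factors, so hypotheses of class \<open>Ck_on\<close>
    would have to be lowered from \<open>Suc k\<close> to \<open>k\<close>, which for
    \<open>k = 0\<close> means deducing continuity from continuous partial derivatives.\<close>
  have "Ck_on k U (\<lambda>q. B (f q) (g q))" if "smooth_fun_on U f" "smooth_fun_on U g" for k f g
    using that
  proof (induction k arbitrary: f g)
    case 0
    show ?case
      using bounded_bilinear.continuous_on[OF assms(1) smooth_fun_on_imp_continuous_on[OF 0(1)]
          smooth_fun_on_imp_continuous_on[OF 0(2)]] by simp
  next
    case (Suc k)
    show ?case
    proof (rule Ck_on_Suc_intro[OF assms(2)])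
      show "has_pds (\<lambda>q. B (f q) (g q))
        (B (f p) (pdx g p) + B (pdx f p) (g p)) (B (f p) (pdy g p) + B (pdy f p) (g p)) p"
        if "p \<in> U" for p
        by (rule has_pds_bilinear[OF assms(1) smooth_fun_on_has_pds[OF Suc.prems(1) that]
              smooth_fun_on_has_pds[OF Suc.prems(2) that]])
    qed (intro Ck_on_add assms(2) Suc.IH smooth_fun_on_pd Suc.prems)+
  qed
  from this[OF assms(3,4)] show ?thesis
    by (simp add: smooth_fun_on_def)
qed

lemmas smooth_fun_on_mult = smooth_fun_on_bilinear[OF bounded_bilinear_mult]

lemma smooth_fun_on_divide:
  fixes f g :: "real \<times> real \<Rightarrow> real"
  assumes "open U" "smooth_fun_on U f" "smooth_fun_on U g" "\<And>p. p \<in> U \<Longrightarrow> g p \<noteq> 0"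
  shows "smooth_fun_on U (\<lambda>q. f q / g q)"
proof -
  have "Ck_on k U (\<lambda>q. f q / g q)"
    if "smooth_fun_on U f" "smooth_fun_on U g" "\<And>p. p \<in> U \<Longrightarrow> g p \<noteq> 0"
    for k and f g :: "real \<times> real \<Rightarrow> real"
    using that
  proof (induction k arbitrary: f g)
    case 0
    show ?case
      using continuous_on_divide[OF smooth_fun_on_imp_continuous_on[OF 0(1)]
          smooth_fun_on_imp_continuous_on[OF 0(2)]] 0(3) by simp
  next
    case (Suc k)
    show ?case
    proof (rule Ck_on_Suc_intro[OF assms(1)])
      show "has_pds (\<lambda>q. f q / g q)
        ((pdx f p * g p - f p * pdx g p) / (g p * g p))
        ((pdy f p * g p - f p * pdy g p) / (g p * g p)) p" if "p \<in> U" for p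
        by (rule has_pds_divide[OF smooth_fun_on_has_pds[OF Suc.prems(1) that]
              smooth_fun_on_has_pds[OF Suc.prems(2) that] Suc.prems(3)[OF that]])
    qed (intro Suc.IH smooth_fun_on_diff smooth_fun_on_mult assms(1) smooth_fun_on_pd Suc.prems(1,2);
        simp add: Suc.prems(3))+
  qed
  from this[OF assms(2-4)] show ?thesis
    by (simp add: smooth_fun_on_def)
qed

section \<open>Symmetry of second partial derivatives\<close>

lemma second_difference_mean_value:
  fixes f fx fxy :: "real \<Rightarrow> real \<Rightarrow> real"
  assumes "h > 0"
    and fx: "\<And>s t. s \<in> {a..a + h} \<Longrightarrow> t \<in> {b..b + h} \<Longrightarrow>
      ((\<lambda>s. f s t) has_real_derivative fx s t) (at s)"
    and fxy: "\<And>s t. s \<in> {a..a + h} \<Longrightarrow> t \<in> {b..b + h} \<Longrightarrow>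
      (fx s has_real_derivative fxy s t) (at t)"
  shows "\<exists>s\<in>{a..a + h}. \<exists>t\<in>{b..b + h}.
    f (a + h) (b + h) - f (a + h) b - f a (b + h) + f a b = h * h * fxy s t"
proof -
  \<comment> \<open>The second difference is an increment in \<open>s\<close> of the difference of
    two slices. The mean value theorem is applied to it in \<open>s\<close>, and then to
    \<open>fx s\<close> in \<open>t\<close>.\<close>
  have "((\<lambda>s. f s (b + h) - f s b) has_real_derivative fx s (b + h) - fx s b) (at s)"
    if "a \<le> s" "s \<le> a + h" for s
    using that assms(1) by (intro DERIV_diff fx) auto
  then obtain s where s: "a < s" "s < a + h"
    "(f (a + h) (b + h) - f (a + h) b) - (f a (b + h) - f a b) = h * (fx s (b + h) - fx s b)"
    using MVT2[of a "a + h" "\<lambda>s. f s (b + h) - f s b" "\<lambda>s. fx s (b + h) - fx s b"] assms(1)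
    by auto
  obtain t where t: "b < t" "t < b + h" "fx s (b + h) - fx s b = h * fxy s t"
    using MVT2[of b "b + h" "fx s" "fxy s"] fxy[of s] s assms(1) by auto
  show ?thesis
    using s t by (intro bexI[of _ s] bexI[of _ t]) auto
qed

text \<open>Two mean value forms of the same second difference over a small square at \<open>p\<close>.\<close>
lemma mixed_pds_eq_real:
  fixes f :: "real \<times> real \<Rightarrow> real"
  assumes "open U" "smooth_fun_on U f" "p \<in> U"
  shows "pdx (pdy f) p = pdy (pdx f) p"
proof (rule ccontr)
  assume ne: "pdx (pdy f) p \<noteq> pdy (pdx f) p"
  define e where "e = \<bar>pdx (pdy f) p - pdy (pdx f) p\<bar> / 2"
  have "e > 0" using ne by (simp add: e_def)
  note sm = smooth_fun_on_pd[OF assms(2)]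
  have "continuous_on U (pdx (pdy f))" "continuous_on U (pdy (pdx f))"
    using sm smooth_fun_on_pd smooth_fun_on_imp_continuous_on by blast+
  then have "isCont (pdx (pdy f)) p" "isCont (pdy (pdx f)) p"
    using assms continuous_on_eq_continuous_at by blast+
  then obtain d1 d2 where d: "d1 > 0" "d2 > 0"
    "\<And>q. dist q p < d1 \<Longrightarrow> dist (pdx (pdy f) q) (pdx (pdy f) p) < e"
    "\<And>q. dist q p < d2 \<Longrightarrow> dist (pdy (pdx f) q) (pdy (pdx f) p) < e"
    using \<open>e > 0\<close> unfolding continuous_at_eps_delta by metis
  obtain r where r: "r > 0" "ball p r \<subseteq> U"
    using assms(1,3) openE by blast
  \<comment> \<open>Points of the square of side \<open>h\<close> at \<open>p\<close> have distance
    at most \<open>2 * h\<close> from \<open>p\<close>, so a third of each radius leaves strict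
    inequalities.\<close>
  define h where "h = min r (min d1 d2) / 3"
  have h: "h > 0" "3 * h \<le> r" "3 * h \<le> d1" "3 * h \<le> d2"
    using d(1,2) r(1) by (auto simp: h_def min_def)
  obtain a b where p: "p = (a, b)" by fastforce
  have near: "dist (s, t) p < 3 * h" if "s \<in> {a..a + h}" "t \<in> {b..b + h}" for s t
  proof -
    have "dist (s, t) p \<le> \<bar>s - a\<bar> + \<bar>t - b\<bar>"
      using sqrt_sum_squares_le_sum_abs[of "s - a" "t - b"] by (simp add: p dist_Pair_Pair dist_real_def)
    then show ?thesis using that h(1) by auto
  qed
  have inU: "(s, t) \<in> U" if "s \<in> {a..a + h}" "t \<in> {b..b + h}" for s t
    using near[OF that] r(2) h(2) by (auto simp: dist_commute subset_iff)
  have D: "((\<lambda>s. f (s, t)) has_real_derivative pdx f (s, t)) (at s)"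
    "((\<lambda>t. f (s, t)) has_real_derivative pdy f (s, t)) (at t)"
    "((\<lambda>t. pdx f (s, t)) has_real_derivative pdy (pdx f) (s, t)) (at t)"
    "((\<lambda>s. pdy f (s, t)) has_real_derivative pdx (pdy f) (s, t)) (at s)"
    if "s \<in> {a..a + h}" "t \<in> {b..b + h}" for s t
    using smooth_fun_on_has_pds[OF assms(2) inU[OF that]]
      smooth_fun_on_has_pds[OF sm(1) inU[OF that]] smooth_fun_on_has_pds[OF sm(2) inU[OF that]]
    by (auto simp: has_pds_def has_real_derivative_iff_has_vector_derivative)
  let ?\<Delta> = "f (a + h, b + h) - f (a + h, b) - f (a, b + h) + f (a, b)"
  obtain s t where st: "s \<in> {a..a + h}" "t \<in> {b..b + h}" "?\<Delta> = h * h * pdy (pdx f) (s, t)"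
    using second_difference_mean_value[of h a b "\<lambda>s t. f (s, t)" "\<lambda>s t. pdx f (s, t)"
        "\<lambda>s t. pdy (pdx f) (s, t)"] D h(1) by auto
  obtain s' t' where st': "s' \<in> {a..a + h}" "t' \<in> {b..b + h}"
    "?\<Delta> = h * h * pdx (pdy f) (s', t')"
    \<comment> \<open>Exchanging the variables leaves the second difference unchanged but expresses
      it by the other mixed derivative.\<close>
    using second_difference_mean_value[of h b a "\<lambda>t s. f (s, t)" "\<lambda>t s. pdy f (s, t)"
        "\<lambda>t s. pdx (pdy f) (s, t)"] D h(1) by (force simp: algebra_simps)
  have "pdy (pdx f) (s, t) = pdx (pdy f) (s', t')"
    using st(3) st'(3) h(1) by simp
  moreover have "\<bar>pdx (pdy f) (s', t') - pdx (pdy f) p\<bar> < e"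
    using d(3)[of "(s', t')"] near[OF st'(1,2)] h(3) by (auto simp: dist_real_def)
  moreover have "\<bar>pdy (pdx f) (s, t) - pdy (pdx f) p\<bar> < e"
    using d(4)[of "(s, t)"] near[OF st(1,2)] h(4) by (auto simp: dist_real_def)
  \<comment> \<open>A common value would lie within \<open>e\<close> of two numbers that are
    \<open>2 * e\<close> apart.\<close>
  ultimately show False
    unfolding e_def by (simp add: abs_if split: if_splits)
qed

lemma pd_transform:
  assumes "open U" "p \<in> U" "smooth_fun_on U f" "\<And>q. q \<in> U \<Longrightarrow> f q = g q"
  shows "pdx g p = pdx f p" "pdy g p = pdy f p"
proof -
  have "has_pds g (pdx f p) (pdy f p) p"
    by (rule has_pds_transform[OF smooth_fun_on_has_pds[OF assms(3,2)] assms(1,2,4)])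
  from has_pds_imp_eq[OF this] show "pdx g p = pdx f p" "pdy g p = pdy f p" .
qed

lemma pd_linear:
  assumes "bounded_linear A" "smooth_fun_on U f" "p \<in> U"
  shows "pdx (\<lambda>q. A (f q)) p = A (pdx f p)" "pdy (\<lambda>q. A (f q)) p = A (pdy f p)"
  using has_pds_imp_eq[OF has_pds_linear[OF assms(1) smooth_fun_on_has_pds[OF assms(2,3)]]] .

lemma pd2_linear:
  assumes "bounded_linear A" "open U" "smooth_fun_on U f" "p \<in> U"
  shows "pdx (pdx (\<lambda>q. A (f q))) p = A (pdx (pdx f) p)"
    "pdy (pdx (\<lambda>q. A (f q))) p = A (pdy (pdx f) p)"
    "pdx (pdy (\<lambda>q. A (f q))) p = A (pdx (pdy f) p)"
    "pdy (pdy (\<lambda>q. A (f q))) p = A (pdy (pdy f) p)"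
proof -
  note sm = smooth_fun_on_pd[OF assms(3)]
  note x = pd_transform[OF assms(2,4) smooth_fun_on_linear[OF assms(2,1) sm(1)], of "pdx (\<lambda>q. A (f q))"]
  note y = pd_transform[OF assms(2,4) smooth_fun_on_linear[OF assms(2,1) sm(2)], of "pdy (\<lambda>q. A (f q))"]
  show "pdx (pdx (\<lambda>q. A (f q))) p = A (pdx (pdx f) p)"
    "pdy (pdx (\<lambda>q. A (f q))) p = A (pdy (pdx f) p)"
    using x pd_linear[OF assms(1,3)] pd_linear[OF assms(1) sm(1) assms(4)] by simp_all
  show "pdx (pdy (\<lambda>q. A (f q))) p = A (pdx (pdy f) p)"
    "pdy (pdy (\<lambda>q. A (f q))) p = A (pdy (pdy f) p)"
    using y pd_linear[OF assms(1,3)] pd_linear[OF assms(1) sm(2) assms(4)] by simp_all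
qed

text \<open>Vectors are equal when their inner products with every \<open>b\<close> agree, which
  reduces the claim to real functions.\<close>

lemma mixed_pds_eq:
  fixes f :: "real \<times> real \<Rightarrow> 'a::real_inner"
  assumes "open U" "smooth_fun_on U f" "p \<in> U"
  shows "pdx (pdy f) p = pdy (pdx f) p"
proof (subst vector_eq_rdot[symmetric], rule allI)
  fix b
  have "pdx (pdy (\<lambda>q. f q \<bullet> b)) p = pdy (pdx (\<lambda>q. f q \<bullet> b)) p"
    by (rule mixed_pds_eq_real[OF assms(1) smooth_fun_on_linear[OF assms(1) _ assms(2)] assms(3)])
      (rule bounded_linear_inner_left)
  then show "pdx (pdy f) p \<bullet> b = pdy (pdx f) p \<bullet> b"
    by (simp add: pd2_linear[OF bounded_linear_inner_left assms])
qed

section \<open>Adapted frames in Minkowski space\<close>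

text \<open>The Euclidean cross product with its third component negated. This sign makes
  \<open>mink (mcross a b) c\<close> the determinant, so the product is
  \<open>mink\<close>-orthogonal to both factors.\<close>

definition mcross :: "real^3 \<Rightarrow> real^3 \<Rightarrow> real^3" where
  "mcross a b = vector [a$2 * b$3 - a$3 * b$2, a$3 * b$1 - a$1 * b$3, a$2 * b$1 - a$1 * b$2]"

lemma mcross_nth [simp]:
  "mcross a b $ 1 = a$2 * b$3 - a$3 * b$2"
  "mcross a b $ 2 = a$3 * b$1 - a$1 * b$3"
  "mcross a b $ 3 = a$2 * b$1 - a$1 * b$2"
  by (simp_all add: mcross_def)

lemma bounded_bilinear_mink: "bounded_bilinear mink"
  unfolding bilinear_conv_bounded_bilinear[symmetric] bilinear_def
  by (auto intro!: linearI simp: mink_def algebra_simps)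

lemma bounded_bilinear_mcross: "bounded_bilinear mcross"
  unfolding bilinear_conv_bounded_bilinear[symmetric] bilinear_def
  by (auto intro!: linearI simp: vec_eq_iff forall_3 algebra_simps)

lemma mink_linear:
  "mink (a + b) c = mink a c + mink b c" "mink (a - b) c = mink a c - mink b c"
  "mink (r *\<^sub>R a) c = r * mink a c"
  by (simp_all add: mink_def algebra_simps)

lemma mink_commute: "mink a b = mink b a"
  by (simp add: mink_def mult.commute)

lemma mink_mcross: "mink (mcross a b) c = det (vector [a, b, c] :: real^3^3)"
  by (simp add: mink_def det_3 algebra_simps)

text \<open>Lagrange's identity, with the sign opposite to the Euclidean one.\<close>

lemma mink_mcross_mcross: "mink (mcross a b) (mcross a b) = (mink a b)\<^sup>2 - mink a a * mink b b"
  by (simp add: mink_def power2_eq_square algebra_simps)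

text \<open>Pointwise linear algebra of the unnormalised tangent vectors and the normal. Keeping the
  factor \<open>E\<close> avoids square roots.\<close>

locale adapted_frame =
  fixes x y n :: "real^3" and E :: real
  assumes E_pos: "E > 0"
    and xx: "mink x x = E" and yy: "mink y y = - E" and nn: "mink n n = 1"
    and xy: "mink x y = 0" and xn: "mink x n = 0" and yn: "mink y n = 0"
    and det_pos: "det (vector [x, y, n] :: real^3^3) > 0"
begin

lemma orthogonal_imp_zero:
  assumes "mink v x = 0" "mink v y = 0" "mink v n = 0"
  shows "v = 0"
proof -
  define d where "d = det (vector [x, y, n] :: real^3^3)"
  \<comment> \<open>Cramer's rule for the system with rows \<open>x\<close>, \<open>y\<close>,
    \<open>n\<close>; the sign of the third coordinate in \<open>mink\<close> produces
    \<open>- d\<close> in the last equation.\<close>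
  have "d * v$1 = mink v x * (y$2 * n$3 - y$3 * n$2) - mink v y * (x$2 * n$3 - x$3 * n$2)
      + mink v n * (x$2 * y$3 - x$3 * y$2)"
    "d * v$2 = mink v x * (y$3 * n$1 - y$1 * n$3) - mink v y * (x$3 * n$1 - x$1 * n$3)
      + mink v n * (x$3 * y$1 - x$1 * y$3)"
    "- d * v$3 = mink v x * (y$1 * n$2 - y$2 * n$1) - mink v y * (x$1 * n$2 - x$2 * n$1)
      + mink v n * (x$1 * y$2 - x$2 * y$1)"
    by (simp_all add: d_def det_3 mink_def algebra_simps)
  then show ?thesis
    using det_pos assms by (simp add: d_def[symmetric] vec_eq_iff forall_3)
qed

text \<open>The difference of the two sides is orthogonal to the whole frame. The minus sign
  reflects that \<open>y\<close> has square \<open>- E\<close>.\<close>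

lemma expansion: "v = (mink v x / E) *\<^sub>R x - (mink v y / E) *\<^sub>R y + mink v n *\<^sub>R n"
proof -
  have "v - ((mink v x / E) *\<^sub>R x - (mink v y / E) *\<^sub>R y + mink v n *\<^sub>R n) = 0"
    using E_pos
    by (intro orthogonal_imp_zero)
      (simp_all add: mink_linear xx yy nn xy xn yn
        mink_commute[of y x] mink_commute[of n x] mink_commute[of n y])
  then show ?thesis by simp
qed

text \<open>The product \<open>mcross x y\<close> is orthogonal to \<open>x\<close> and
  \<open>y\<close>, hence a multiple of \<open>n\<close> by the determinant. Lagrange's identity
  gives the square of that factor, and the orientation fixes its sign.\<close>

lemma det_eq: "det (vector [x, y, n] :: real^3^3) = E"
proof -
  define d where "d = det (vector [x, y, n] :: real^3^3)"
  have "mink (mcross x y) x = 0" "mink (mcross x y) y = 0" "mink (mcross x y) n = d"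
    by (simp_all add: d_def mink_mcross) (simp_all add: det_3)
  then have "mcross x y = d *\<^sub>R n"
    using expansion[of "mcross x y"] by simp
  then have "d * d = mink (mcross x y) (mcross x y)"
    by (simp add: mink_linear mink_commute[of n "_ *\<^sub>R _"] nn)
  then have "d\<^sup>2 = E\<^sup>2"
    by (simp add: mink_mcross_mcross xx yy xy power2_eq_square)
  then show ?thesis
    using det_pos E_pos d_def by (simp add: power2_eq_iff_nonneg)
qed

text \<open>Pairing each product with a frame vector gives a determinant with a repeated row or a
  cyclic permutation of the frame; \<open>expansion\<close> then recovers the product.\<close>

lemma mcross_frame: "mcross x y = E *\<^sub>R n" "mcross y n = x" "mcross n x = - y"
proof -
  have "mink (mcross x y) x = 0" "mink (mcross x y) y = 0" "mink (mcross x y) n = E"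
    "mink (mcross y n) x = E" "mink (mcross y n) y = 0" "mink (mcross y n) n = 0"
    "mink (mcross n x) x = 0" "mink (mcross n x) y = E" "mink (mcross n x) n = 0"
    by (simp_all add: mink_mcross det_eq[symmetric]) (simp_all add: det_3 algebra_simps)
  then show "mcross x y = E *\<^sub>R n" "mcross y n = x" "mcross n x = - y"
    using E_pos expansion[of "mcross x y"] expansion[of "mcross y n"] expansion[of "mcross n x"]
    by simp_all
qed

text \<open>Componentwise \<open>x x\<^sup>T - y y\<^sup>T + E n n\<^sup>T = E diag(1, 1, -1)\<close>.\<close>
lemma completeness:
  "x$1 * x$1 - y$1 * y$1 + E * (n$1 * n$1) = E"
  "x$2 * x$2 - y$2 * y$2 + E * (n$2 * n$2) = E"
  "x$3 * x$3 - y$3 * y$3 + E * (n$3 * n$3) = - E"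
  "x$1 * x$2 - y$1 * y$2 + E * (n$1 * n$2) = 0"
  "x$1 * x$3 - y$1 * y$3 + E * (n$1 * n$3) = 0"
  "x$2 * x$3 - y$2 * y$3 + E * (n$2 * n$3) = 0"
proof -
  have e: "E * axis i 1 $ j =
    mink (axis i 1) x * x$j - mink (axis i 1) y * y$j + E * (mink (axis i 1) n * n$j)" for i j
  proof -
    have "axis i 1 $ j = mink (axis i 1) x / E * x$j - mink (axis i 1) y / E * y$j
      + mink (axis i 1) n * n$j"
      using arg_cong[OF expansion[of "axis i 1"], of "\<lambda>v. v $ j"] by simp
    then show ?thesis using E_pos by (simp add: field_simps)
  qed
  have [simp]: "mink (axis 1 1) v = v$1" "mink (axis 2 1) v = v$2" "mink (axis 3 1) v = - v$3" for v
    by (simp_all add: mink_def axis_def)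
  have [simp]: "axis i 1 $ j = (if j = i then 1 else 0 :: real)" for i j :: 3
    by (simp add: axis_def)
  show "x$1 * x$1 - y$1 * y$1 + E * (n$1 * n$1) = E"
    "x$2 * x$2 - y$2 * y$2 + E * (n$2 * n$2) = E"
    "x$3 * x$3 - y$3 * y$3 + E * (n$3 * n$3) = - E"
    "x$1 * x$2 - y$1 * y$2 + E * (n$1 * n$2) = 0"
    "x$1 * x$3 - y$1 * y$3 + E * (n$1 * n$3) = 0"
    "x$2 * x$3 - y$2 * y$3 + E * (n$2 * n$3) = 0"
    using e[of 1 1] e[of 2 2] e[of 3 3] e[of 1 2] e[of 1 3] e[of 2 3]
    by (simp_all add: algebra_simps)
qed

lemma frame_nth:
  "x$2 * y$3 - x$3 * y$2 = E * n$1" "x$3 * y$1 - x$1 * y$3 = E * n$2" "x$2 * y$1 - x$1 * y$2 = E * n$3"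
  "y$2 * n$3 - y$3 * n$2 = x$1" "y$3 * n$1 - y$1 * n$3 = x$2" "y$2 * n$1 - y$1 * n$2 = x$3"
  "n$2 * x$3 - n$3 * x$2 = - y$1" "n$3 * x$1 - n$1 * x$3 = - y$2" "n$2 * x$1 - n$1 * x$2 = - y$3"
  using arg_cong[OF mcross_frame(1), of "\<lambda>v. v $ _"] arg_cong[OF mcross_frame(2), of "\<lambda>v. v $ _"]
    arg_cong[OF mcross_frame(3), of "\<lambda>v. v $ _"]
  by (metis mcross_nth vector_scaleR_component real_scaleR_def vector_uminus_component)+

text \<open>With the Weingarten equations, the left sides are, up to sign and a common denominator,
  the partial derivatives of the two stereographic coordinates. The right sides match in pairs up to
  sign, which gives the Cauchy-Riemann equations.\<close>

lemma stereographic_Cauchy_Riemann: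
  "x$2 * (1 - n$1) + n$2 * x$1 = x$2 - y$3" "y$3 * (1 - n$1) + n$3 * y$1 = y$3 - x$2"
  "y$2 * (1 - n$1) + n$2 * y$1 = y$2 - x$3" "x$3 * (1 - n$1) + n$3 * x$1 = x$3 - y$2"
  using frame_nth by (simp_all add: algebra_simps)

text \<open>The Lorentz square norm of the numerator of \<open>w'\<close>; it yields both the value
  of \<open>mu\<close> and the invertibility of \<open>w'\<close>.\<close>

lemma stereographic_conformal: "(y$3 - x$2)\<^sup>2 - (y$2 - x$3)\<^sup>2 = E * (1 - n$1)\<^sup>2"
proof -
  have "mink x x - mink y y = 2 * E" by (simp add: xx yy)
  then show ?thesis
    using completeness(1) frame_nth(1) by (simp add: mink_def power2_eq_square algebra_simps)
qed

lemma stereographic_norm: "(n$2)\<^sup>2 - (n$3)\<^sup>2 = (1 - n$1) * (1 + n$1)"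
  using nn by (simp add: mink_def power2_eq_square algebra_simps)

text \<open>The real and \<open>j\<close>-parts of \<open>x$i + j y$i\<close> times the numerator of
  \<open>w'\<close>, doubled where the representation has a factor one half.\<close>

lemma weierstrass_products:
  "x$1 * (y$3 - x$2) + y$1 * (y$2 - x$3) = - (E * n$2 * (1 - n$1))"
  "x$1 * (y$2 - x$3) + y$1 * (y$3 - x$2) = - (E * n$3 * (1 - n$1))"
  "2 * (x$2 * (y$3 - x$2) + y$2 * (y$2 - x$3)) = E * ((n$2)\<^sup>2 + (n$3)\<^sup>2 - (1 - n$1)\<^sup>2)"
  "x$2 * (y$2 - x$3) + y$2 * (y$3 - x$2) = E * (n$2 * n$3)"
  "x$3 * (y$3 - x$2) + y$3 * (y$2 - x$3) = E * (n$2 * n$3)"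
  "2 * (x$3 * (y$2 - x$3) + y$3 * (y$3 - x$2)) = E * ((n$2)\<^sup>2 + (n$3)\<^sup>2 + (1 - n$1)\<^sup>2)"
proof -
  \<comment> \<open>The relation \<open>nn\<close> multiplied by \<open>E\<close>, so that its
    monomials are the ones occurring in \<open>completeness\<close>.\<close>
  have nE: "E * (n$1 * n$1) + E * (n$2 * n$2) - E * (n$3 * n$3) = E"
    using arg_cong[OF nn, of "\<lambda>t. E * t"] by (simp add: mink_def algebra_simps)
  show "x$1 * (y$3 - x$2) + y$1 * (y$2 - x$3) = - (E * n$2 * (1 - n$1))"
    "x$1 * (y$2 - x$3) + y$1 * (y$3 - x$2) = - (E * n$3 * (1 - n$1))"
    "x$2 * (y$2 - x$3) + y$2 * (y$3 - x$2) = E * (n$2 * n$3)"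
    "x$3 * (y$3 - x$2) + y$3 * (y$2 - x$3) = E * (n$2 * n$3)"
    using completeness frame_nth(1-3) by (simp_all add: algebra_simps)
  show "2 * (x$2 * (y$3 - x$2) + y$2 * (y$2 - x$3)) = E * ((n$2)\<^sup>2 + (n$3)\<^sup>2 - (1 - n$1)\<^sup>2)"
    using completeness frame_nth(1-3) nE by (simp add: power2_eq_square algebra_simps)
  show "2 * (x$3 * (y$2 - x$3) + y$3 * (y$3 - x$2)) = E * ((n$2)\<^sup>2 + (n$3)\<^sup>2 + (1 - n$1)\<^sup>2)"
    using completeness frame_nth(1-3) nE by (simp add: power2_eq_square algebra_simps)
qed

end

section \<open>Maximal surfaces in canonical parameters\<close>

lemma has_pds_constant_on:
  assumes "has_pds f a b p" "open U" "p \<in> U" "\<And>q. q \<in> U \<Longrightarrow> f q = c"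
  shows "a = 0" "b = 0"
  using has_pds_imp_eq[OF has_pds_transform[OF assms]] has_pds_imp_eq[OF has_pds_const[of c p]]
  by simp_all

locale canonical_maximal_surface =
  fixes D :: "(real \<times> real) set" and z l :: surf
  assumes surface: "spacelike_principal_surface D z l"
    and maximal: "maximal_on D z l"
    and regular: "strongly_regular_on D z"
    and canonical: "canonical_parameters_on D z l"
begin

lemma open_D: "open D" and smooth_z: "smooth_fun_on D z"
  using surface by (simp_all add: spacelike_principal_surface_def)

lemmas smooth_pd_z = smooth_fun_on_pd[OF smooth_z]

text \<open>Canonical parameters give \<open>E * nu1 = 1\<close>, which is \<open>e = 1\<close>, and
  \<open>G = - E\<close>. Maximality then gives \<open>g = nu2 * G = nu1 * E = 1\<close>.\<close>

lemma second_form: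
  assumes "p \<in> D"
  shows "coefe z l p = 1" "coeff z l p = 0" "coefg z l p = 1" "coefG z p = - coefE z p"
proof -
  have E: "coefE z p > 0" and G: "coefG z p < 0" and f: "coeff z l p = 0"
    and d: "coefe z l p / coefE z p - coefg z l p / coefG z p > 0"
    using surface assms by (auto simp: spacelike_principal_surface_def nu1_def nu2_def)
  have s: "coefe z l p / coefE z p + coefg z l p / coefG z p = 0"
    using maximal assms by (simp add: maximal_on_def nu1_def nu2_def)
  have c: "coefE z p = 1 / (coefe z l p / coefE z p)" "- coefG z p = 1 / (coefe z l p / coefE z p)"
    using canonical assms by (auto simp: canonical_parameters_on_def nu1_def)
  show "coeff z l p = 0" by fact
  show GE: "coefG z p = - coefE z p" using c by simp
  \<comment> \<open>If \<open>e\<close> were zero, the convention for division by zero would make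
    \<open>E\<close> zero, against \<open>E > 0\<close>.\<close>
  show e: "coefe z l p = 1" using c(1) E by (cases "coefe z l p = 0") (auto simp: field_simps)
  show "coefg z l p = 1" using s E unfolding GE e by (simp add: field_simps)
qed

lemma frame:
  assumes "p \<in> D"
  shows "adapted_frame (pdx z p) (pdy z p) (l p) (coefE z p)"
proof
  note s = surface[unfolded spacelike_principal_surface_def]
  show E: "coefE z p > 0" using s assms by blast
  show "mink (pdx z p) (pdx z p) = coefE z p" by (simp add: coefE_def)
  show "mink (pdy z p) (pdy z p) = - coefE z p"
    using second_form(4)[OF assms] by (simp add: coefG_def)
  show "mink (l p) (l p) = 1" "mink (pdx z p) (l p) = 0" "mink (pdy z p) (l p) = 0"
    using s assms by blast+
  show "mink (pdx z p) (pdy z p) = 0" using s assms by (simp add: coefF_def)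
  have "det (vector [frameX z p, frameY z p, l p] :: real^3^3)
    = 1 / coefE z p * det (vector [pdx z p, pdy z p, l p] :: real^3^3)"
    using E second_form(4)[OF assms]
    by (simp add: frameX_def frameY_def det_3 field_simps)
  moreover have "det (vector [frameX z p, frameY z p, l p] :: real^3^3) > 0"
    using s assms by blast
  ultimately show "det (vector [pdx z p, pdy z p, l p] :: real^3^3) > 0"
    using E by (simp add: zero_less_divide_iff)
qed

lemma smooth_E: "smooth_fun_on D (coefE z)"
  unfolding coefE_def[abs_def]
  by (rule smooth_fun_on_bilinear[OF bounded_bilinear_mink open_D smooth_pd_z(1) smooth_pd_z(1)])

text \<open>Smoothness of the normal is not part of the surface predicate; it is inherited from
  \<open>z\<close> through the cross product formula for \<open>l\<close>.\<close>

lemma smooth_l: "smooth_fun_on D l"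
proof (rule smooth_fun_on_transform[OF open_D])
  show "smooth_fun_on D (\<lambda>q. (1 / coefE z q) *\<^sub>R mcross (pdx z q) (pdy z q))"
  proof (rule smooth_fun_on_bilinear[OF bounded_bilinear_scaleR open_D])
    show "smooth_fun_on D (\<lambda>q. 1 / coefE z q)"
      using adapted_frame.E_pos[OF frame]
      by (intro smooth_fun_on_divide[OF open_D smooth_fun_on_const[OF open_D] smooth_E]) force
    show "smooth_fun_on D (\<lambda>q. mcross (pdx z q) (pdy z q))"
      by (rule smooth_fun_on_bilinear[OF bounded_bilinear_mcross open_D smooth_pd_z])
  qed
  show "(1 / coefE z p) *\<^sub>R mcross (pdx z p) (pdy z p) = l p" if "p \<in> D" for p
    using adapted_frame.mcross_frame(1)[OF frame[OF that]] adapted_frame.E_pos[OF frame[OF that]]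
    by simp
qed

text \<open>Differentiating the orthogonality relations of \<open>l\<close> with
  \<open>pdx z\<close>, \<open>pdy z\<close> and itself gives the products of its derivatives with
  the frame in terms of \<open>e = g = 1\<close> and \<open>f = 0\<close>. Symmetry of mixed
  derivatives supplies the remaining one, and \<open>expansion\<close> concludes.\<close>

lemma Weingarten:
  assumes "p \<in> D"
  shows "pdx l p = - ((1 / coefE z p) *\<^sub>R pdx z p)" "pdy l p = (1 / coefE z p) *\<^sub>R pdy z p"
proof -
  interpret adapted_frame "pdx z p" "pdy z p" "l p" "coefE z p"
    by (rule frame[OF assms])
  note L = smooth_fun_on_has_pds[OF smooth_l assms]
  have xl: "mink (pdx z p) (pdx l p) + mink (pdx (pdx z) p) (l p) = 0"
    "mink (pdx z p) (pdy l p) + mink (pdy (pdx z) p) (l p) = 0"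
    by (rule has_pds_constant_on[OF has_pds_bilinear[OF bounded_bilinear_mink
            smooth_fun_on_has_pds[OF smooth_pd_z(1) assms] L] open_D assms],
        erule adapted_frame.xn[OF frame])+
  have yl: "mink (pdy z p) (pdx l p) + mink (pdx (pdy z) p) (l p) = 0"
    "mink (pdy z p) (pdy l p) + mink (pdy (pdy z) p) (l p) = 0"
    by (rule has_pds_constant_on[OF has_pds_bilinear[OF bounded_bilinear_mink
            smooth_fun_on_has_pds[OF smooth_pd_z(2) assms] L] open_D assms],
        erule adapted_frame.yn[OF frame])+
  have ll: "mink (l p) (pdx l p) + mink (pdx l p) (l p) = 0"
    "mink (l p) (pdy l p) + mink (pdy l p) (l p) = 0"
    by (rule has_pds_constant_on[OF has_pds_bilinear[OF bounded_bilinear_mink L L] open_D assms],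
        erule adapted_frame.nn[OF frame])+
  note c = mink_commute[of "pdx l p"] mink_commute[of "pdy l p"]
  have "mink (pdx l p) (pdx z p) = - 1" "mink (pdx l p) (pdy z p) = 0" "mink (pdx l p) (l p) = 0"
    "mink (pdy l p) (pdx z p) = 0" "mink (pdy l p) (pdy z p) = - 1" "mink (pdy l p) (l p) = 0"
    using xl yl ll second_form[OF assms] mixed_pds_eq[OF open_D smooth_z assms]
    by (simp_all add: c coefe_def coeff_def coefg_def)
  then show "pdx l p = - ((1 / coefE z p) *\<^sub>R pdx z p)" "pdy l p = (1 / coefE z p) *\<^sub>R pdy z p"
    using expansion[of "pdx l p"] expansion[of "pdy l p"] by simp_all
qed

lemma has_pds_l_nth:
  assumes "p \<in> D"
  shows "has_pds (\<lambda>q. l q $ i) (- (pdx z p $ i / coefE z p)) (pdy z p $ i / coefE z p) p"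
  using has_pds_linear[OF bounded_linear_vec_nth smooth_fun_on_has_pds[OF smooth_l assms], of i]
  by (simp add: Weingarten[OF assms])

section \<open>The stereographic Weierstrass function and the representation\<close>

definition weierstrass :: "real \<times> real \<Rightarrow> lorentz" where
  "weierstrass q = Lor (l q $ 2 / (1 - l q $ 1)) (l q $ 3 / (1 - l q $ 1))"

definition chart :: "(real \<times> real) set" where
  "chart = {q \<in> D. l q $ 1 \<noteq> 1}"

lemma open_chart: "open chart"
proof -
  have "continuous_on D (\<lambda>q. l q $ 1)"
    using smooth_fun_on_imp_continuous_on[OF smooth_l] by (rule continuous_on_component)
  then have "open (D \<inter> (\<lambda>q. l q $ 1) -` (- {1}))"
    by (rule continuous_open_preimage[OF _ open_D]) auto
  moreover have "D \<inter> (\<lambda>q. l q $ 1) -` (- {1}) = chart"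
    by (auto simp: chart_def)
  ultimately show ?thesis by simp
qed

lemma smooth_chart: "smooth_fun_on chart (\<lambda>q. l q $ i / (1 - l q $ 1))"
proof -
  have l: "smooth_fun_on chart (\<lambda>q. l q $ j)" for j
    using smooth_fun_on_linear[OF open_D bounded_linear_vec_nth smooth_l]
    by (rule smooth_fun_on_subset) (auto simp: chart_def)
  show ?thesis
    by (intro smooth_fun_on_divide smooth_fun_on_diff smooth_fun_on_const l open_chart)
      (simp add: chart_def)
qed

lemma pds_stereographic:
  assumes "p \<in> chart"
  shows "pdx (\<lambda>q. l q $ i / (1 - l q $ 1)) p =
      - (pdx z p $ i * (1 - l p $ 1) + l p $ i * pdx z p $ 1) / (coefE z p * (1 - l p $ 1)\<^sup>2)"
    "pdy (\<lambda>q. l q $ i / (1 - l q $ 1)) p =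
      (pdy z p $ i * (1 - l p $ 1) + l p $ i * pdy z p $ 1) / (coefE z p * (1 - l p $ 1)\<^sup>2)"
proof -
  have p: "p \<in> D" and ne: "1 - l p $ 1 \<noteq> 0" using assms by (auto simp: chart_def)
  have E: "coefE z p \<noteq> 0" using adapted_frame.E_pos[OF frame[OF p]] by simp
  note h = has_pds_imp_eq[OF has_pds_divide[OF has_pds_l_nth[OF p]
        has_pds_diff[OF has_pds_const has_pds_l_nth[OF p]] ne]]
  show "pdx (\<lambda>q. l q $ i / (1 - l q $ 1)) p =
      - (pdx z p $ i * (1 - l p $ 1) + l p $ i * pdx z p $ 1) / (coefE z p * (1 - l p $ 1)\<^sup>2)"
    unfolding h using ne E by (simp add: divide_simps power2_eq_square; simp add: algebra_simps)
  show "pdy (\<lambda>q. l q $ i / (1 - l q $ 1)) p =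
      (pdy z p $ i * (1 - l p $ 1) + l p $ i * pdy z p $ 1) / (coefE z p * (1 - l p $ 1)\<^sup>2)"
    unfolding h using ne E by (simp add: divide_simps power2_eq_square; simp add: algebra_simps)
qed

lemma pds_weierstrass:
  assumes "p \<in> chart"
  defines "r \<equiv> coefE z p * (1 - l p $ 1)\<^sup>2"
  shows "pdx (\<lambda>q. lre (weierstrass q)) p = (pdy z p $ 3 - pdx z p $ 2) / r"
    "pdy (\<lambda>q. lre (weierstrass q)) p = (pdy z p $ 2 - pdx z p $ 3) / r"
    "pdx (\<lambda>q. lim (weierstrass q)) p = (pdy z p $ 2 - pdx z p $ 3) / r"
    "pdy (\<lambda>q. lim (weierstrass q)) p = (pdy z p $ 3 - pdx z p $ 2) / r"
proof -
  have p: "p \<in> D" using assms by (auto simp: chart_def)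
  interpret adapted_frame "pdx z p" "pdy z p" "l p" "coefE z p"
    by (rule frame[OF p])
  show "pdx (\<lambda>q. lre (weierstrass q)) p = (pdy z p $ 3 - pdx z p $ 2) / r"
    "pdy (\<lambda>q. lre (weierstrass q)) p = (pdy z p $ 2 - pdx z p $ 3) / r"
    "pdx (\<lambda>q. lim (weierstrass q)) p = (pdy z p $ 2 - pdx z p $ 3) / r"
    "pdy (\<lambda>q. lim (weierstrass q)) p = (pdy z p $ 3 - pdx z p $ 2) / r"
    by (simp_all only: weierstrass_def lorentz.sel pds_stereographic[OF assms(1)]
        stereographic_Cauchy_Riemann r_def minus_diff_eq)
qed

lemma holomorphic_weierstrass: "lorentz_holomorphic_on weierstrass chart"
  unfolding lorentz_holomorphic_on_def lorentz_Cauchy_Riemann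
  using smooth_chart pds_weierstrass by (simp add: weierstrass_def)

lemma lderiv_weierstrass:
  assumes "p \<in> chart"
  shows "lderiv weierstrass p = (1 / (coefE z p * (1 - l p $ 1)\<^sup>2)) *\<^sub>R
    Lor (pdy z p $ 3 - pdx z p $ 2) (pdy z p $ 2 - pdx z p $ 3)"
  by (simp add: lderiv_def lpdx_def lpdy_def pds_weierstrass[OF assms] jj_def
      times_lorentz_def plus_lorentz_def scaleR_lorentz_def diff_divide_distrib)

lemma norm_weierstrass:
  assumes "p \<in> chart"
  shows "(lre (weierstrass p))\<^sup>2 - (lim (weierstrass p))\<^sup>2 + 1 = 2 / (1 - l p $ 1)"
proof -
  have p: "p \<in> D" and ne: "1 - l p $ 1 \<noteq> 0" using assms by (auto simp: chart_def)
  define t where "t = 1 - l p $ 1"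
  have n: "(l p $ 2)\<^sup>2 - (l p $ 3)\<^sup>2 = t * (2 - t)"
    using adapted_frame.stereographic_norm[OF frame[OF p]] by (simp add: t_def)
  have "(lre (weierstrass p))\<^sup>2 - (lim (weierstrass p))\<^sup>2 + 1
    = ((l p $ 2)\<^sup>2 - (l p $ 3)\<^sup>2) / t\<^sup>2 + 1"
    by (simp add: weierstrass_def t_def power_divide diff_divide_distrib)
  also have "\<dots> = 2 / t"
    using ne unfolding n t_def[symmetric] by (simp add: field_simps power2_eq_square)
  finally show ?thesis by (simp add: t_def)
qed

text \<open>All powers of \<open>1 - l p $ 1\<close> cancel between the square norm of
  \<open>w'\<close> and the squared conformal factor of the projection, so \<open>mu\<close> is a
  quarter of the normal curvature.\<close>

lemma mu_weierstrass:
  assumes "p \<in> chart"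
  shows "mu weierstrass p = 1 / (4 * coefE z p)"
proof -
  have p: "p \<in> D" and ne: "1 - l p $ 1 \<noteq> 0" using assms by (auto simp: chart_def)
  have E: "coefE z p > 0" using adapted_frame.E_pos[OF frame[OF p]] .
  define t where "t = 1 - l p $ 1"
  have "mu weierstrass p
    = ((pdy z p $ 3 - pdx z p $ 2)\<^sup>2 - (pdy z p $ 2 - pdx z p $ 3)\<^sup>2) / (coefE z p * t\<^sup>2)\<^sup>2 / (2 / t)\<^sup>2"
    unfolding mu_def norm_weierstrass[OF assms] pds_weierstrass[OF assms] t_def
    by (simp only: power_divide diff_divide_distrib[symmetric])
  also have "\<dots> = coefE z p * t\<^sup>2 / (coefE z p * t\<^sup>2)\<^sup>2 / (2 / t)\<^sup>2"
    using adapted_frame.stereographic_conformal[OF frame[OF p]] by (simp add: t_def)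
  also have "\<dots> = 1 / (4 * coefE z p)"
    using ne E unfolding t_def[symmetric] by (simp add: field_simps power2_eq_square)
  finally show ?thesis .
qed

lemma pds_E_nonzero:
  assumes "p \<in> D"
  shows "pdx (coefE z) p \<noteq> 0" "pdy (coefE z) p \<noteq> 0"
proof -
  have "gamma1 z p * gamma2 z p \<noteq> 0"
    using regular assms by (simp add: strongly_regular_on_def)
  then have "pdx (coefG z) p \<noteq> 0" "pdy (coefE z) p \<noteq> 0"
    by (auto simp: gamma1_def gamma2_def)
  moreover have "pdx (coefG z) p = - pdx (coefE z) p"
    using has_pds_imp_eq(1)[OF has_pds_transform[OF has_pds_linear
          [OF bounded_linear_minus[OF bounded_linear_ident] smooth_fun_on_has_pds[OF smooth_E assms]]
          open_D assms, of "coefG z"]] second_form(4) by simp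
  ultimately show "pdx (coefE z) p \<noteq> 0" "pdy (coefE z) p \<noteq> 0" by auto
qed

lemma admissible_weierstrass: "admissible_on chart weierstrass"
  unfolding admissible_on_def
proof (intro ballI conjI)
  fix p assume p: "p \<in> chart"
  then have D: "p \<in> D" by (simp add: chart_def)
  have E: "coefE z p > 0" using adapted_frame.E_pos[OF frame[OF D]] .
  show "(lre (weierstrass p))\<^sup>2 - (lim (weierstrass p))\<^sup>2 + 1 \<noteq> 0"
    using p by (simp add: norm_weierstrass chart_def)
  show "mu weierstrass p > 0"
    using E by (simp add: mu_weierstrass[OF p])
  have d: "has_pds (\<lambda>q. 1 / 4 / coefE z q)
      (- (1 / 4 * pdx (coefE z) p) / (coefE z p * coefE z p))
      (- (1 / 4 * pdy (coefE z) p) / (coefE z p * coefE z p)) p"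
    using has_pds_divide[OF has_pds_const[of "1 / 4"] smooth_fun_on_has_pds[OF smooth_E D]] E
    by simp
  have "has_pds (mu weierstrass)
      (- (1 / 4 * pdx (coefE z) p) / (coefE z p * coefE z p))
      (- (1 / 4 * pdy (coefE z) p) / (coefE z p * coefE z p)) p"
    by (rule has_pds_transform[OF d open_chart p]) (simp add: mu_weierstrass)
  from has_pds_imp_eq[OF this] pds_E_nonzero[OF D] E
  show "pdx (mu weierstrass) p * pdy (mu weierstrass) p \<noteq> 0" by simp
qed

lemma representation_weierstrass: "represented_by chart z weierstrass"
  unfolding represented_by_def
proof (intro ballI conjI)
  fix p assume p: "p \<in> chart"
  then have D: "p \<in> D" and ne: "1 - l p $ 1 \<noteq> 0" by (auto simp: chart_def)
  interpret adapted_frame "pdx z p" "pdy z p" "l p" "coefE z p"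
    by (rule frame[OF D])
  define t where "t = 1 - l p $ 1"
  define r where "r = coefE z p * t\<^sup>2"
  define W where "W = lderiv weierstrass p"
  have t: "t \<noteq> 0" and r: "r \<noteq> 0" using ne E_pos by (auto simp: t_def r_def)
  have W: "W = (1 / r) *\<^sub>R Lor (pdy z p $ 3 - pdx z p $ 2) (pdy z p $ 2 - pdx z p $ 3)"
    by (simp add: W_def lderiv_weierstrass[OF p] r_def t_def)
  have "(lre W)\<^sup>2 - (lim W)\<^sup>2
    = ((pdy z p $ 3 - pdx z p $ 2)\<^sup>2 - (pdy z p $ 2 - pdx z p $ 3)\<^sup>2) / r\<^sup>2"
    by (simp add: W scaleR_lorentz_def power_divide flip: diff_divide_distrib)
  also have "\<dots> = 1 / r"
    unfolding stereographic_conformal t_def[symmetric] r_def[symmetric]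
    using r by (simp add: power2_eq_square)
  finally have "(lre W)\<^sup>2 - (lim W)\<^sup>2 \<noteq> 0" using r by simp
  then have "W * inverse W = 1" by (rule lorentz_right_inverse)
  \<comment> \<open>Since \<open>W\<close> is a unit and not a zero divisor, each quotient formula
    may be checked after multiplication by \<open>W\<close>.\<close>
  then have quot: "g = b / W" if "g * W = b" for g b
    using that unfolding divide_lorentz_def by (metis mult.assoc mult.right_neutral)
  have grad: "lgrad (\<lambda>q. z q $ i) p = Lor (pdx z p $ i) (pdy z p $ i)" for i
    using pd_linear[OF bounded_linear_vec_nth smooth_z D, of i]
    by (simp add: lgrad_def Lor_eq)
  have w: "weierstrass p = (1 / t) *\<^sub>R Lor (l p $ 2) (l p $ 3)"
    by (simp add: weierstrass_def t_def scaleR_lorentz_def)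
  note P = weierstrass_products[folded t_def]
  note ops = scaleR_lorentz_def times_lorentz_def minus_lorentz_def plus_lorentz_def
    uminus_lorentz_def one_lorentz_def jj_def
  have prod: "Lor a b * W = (1 / r) *\<^sub>R
      Lor (a * (pdy z p $ 3 - pdx z p $ 2) + b * (pdy z p $ 2 - pdx z p $ 3))
        (a * (pdy z p $ 2 - pdx z p $ 3) + b * (pdy z p $ 3 - pdx z p $ 2))" for a b
    unfolding W by (simp add: ops add_divide_distrib)
  have prod2: "(2 *\<^sub>R Lor a b) * W = (1 / r) *\<^sub>R
      Lor (2 * (a * (pdy z p $ 3 - pdx z p $ 2) + b * (pdy z p $ 2 - pdx z p $ 3)))
        (2 * (a * (pdy z p $ 2 - pdx z p $ 3) + b * (pdy z p $ 3 - pdx z p $ 2)))" for a b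
    unfolding mult_scaleR_left prod by (simp add: ops)
  have half: "g = (1/2) *\<^sub>R b" if "2 *\<^sub>R g = b" for g b :: lorentz
    using that by auto
  have "lgrad (\<lambda>q. z q $ 1) p * W = - weierstrass p"
    unfolding grad prod P w using t E_pos
    by (simp add: ops r_def power2_eq_square)
  from quot[OF this] show "lgrad (\<lambda>q. z q $ 1) p = - (weierstrass p / lderiv weierstrass p)"
    by (simp add: W_def divide_lorentz_def)
  have "(2 *\<^sub>R lgrad (\<lambda>q. z q $ 2) p) * W = (weierstrass p)\<^sup>2 - 1"
    unfolding grad prod2 P w using t E_pos
    by (simp add: ops r_def power2_eq_square field_simps)
  from half[OF quot[OF this]]
  show "lgrad (\<lambda>q. z q $ 2) p = (1/2) *\<^sub>R (((weierstrass p)\<^sup>2 - 1) / lderiv weierstrass p)"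
    by (simp add: W_def)
  have "(2 *\<^sub>R lgrad (\<lambda>q. z q $ 3) p) * W = jj * ((weierstrass p)\<^sup>2 + 1)"
    unfolding grad prod2 P w using t E_pos
    by (simp add: ops r_def power2_eq_square field_simps)
  from half[OF quot[OF this]]
  show "lgrad (\<lambda>q. z q $ 3) p =
      (1/2) *\<^sub>R (jj * (((weierstrass p)\<^sup>2 + 1) / lderiv weierstrass p))"
    by (simp add: W_def divide_lorentz_def mult.assoc)
qed

lemma representable:
  assumes "p \<in> D" "l p $ 1 \<noteq> 1"
  shows "representable_near D z p"
  unfolding representable_near_def
  using assms open_chart holomorphic_weierstrass admissible_weierstrass representation_weierstrass
  by (intro exI[of _ chart] exI[of _ weierstrass]) (auto simp: chart_def)

lemma dense_chart: "D \<subseteq> closure {p \<in> D. l p $ 1 \<noteq> 1}"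
proof
  fix p assume "p \<in> D"
  show "p \<in> closure {p \<in> D. l p $ 1 \<noteq> 1}"
  proof (rule ccontr)
    assume np: "p \<notin> closure {p \<in> D. l p $ 1 \<noteq> 1}"
    define V where "V = D - closure {p \<in> D. l p $ 1 \<noteq> 1}"
    have V: "open V" "p \<in> V" "V \<subseteq> D"
      using open_D np \<open>p \<in> D\<close> by (auto simp: V_def)
    have l1: "l q $ 1 = 1" if "q \<in> V" for q
      using that closure_subset[of "{p \<in> D. l p $ 1 \<noteq> 1}"] by (auto simp: V_def)
    \<comment> \<open>By Weingarten, the derivatives of a component of \<open>l\<close> are nonzero
      multiples of those of the same component of \<open>z\<close>, so constancy on \<open>V\<close>
      kills the latter.\<close>
    have vanish: "pdx z q $ i = 0" "pdy z q $ i = 0"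
      if "\<And>q. q \<in> V \<Longrightarrow> l q $ i = c" "q \<in> V" for q i c
    proof -
      have q: "q \<in> D" using V(3) that(2) by auto
      show "pdx z q $ i = 0" "pdy z q $ i = 0"
        using has_pds_constant_on[OF has_pds_l_nth[OF q] V(1) that(2) that(1)]
          adapted_frame.E_pos[OF frame[OF q]] by simp_all
    qed
    \<comment> \<open>The first components of both tangent vectors vanish, so their cross product
      has zero second and third components. These components of \<open>l\<close> are then constant
      too, and \<open>vanish\<close> applies again.\<close>
    have l2: "l q $ 2 = 0" and l3: "l q $ 3 = 0" if "q \<in> V" for q
    proof -
      have q: "q \<in> D" using V(3) that by auto
      show "l q $ 2 = 0" "l q $ 3 = 0"
        using adapted_frame.frame_nth(2,3)[OF frame[OF q]] vanish[OF l1 that]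
          adapted_frame.E_pos[OF frame[OF q]] by simp_all
    qed
    have "coefE z p = 0"
      using vanish[OF l1 V(2)] vanish[OF l2 V(2)] vanish[OF l3 V(2)]
      by (simp add: coefE_def mink_def)
    then show False
      using adapted_frame.E_pos[OF frame[OF \<open>p \<in> D\<close>]] by simp
  qed
qed

end

section \<open>Moving the normal away from the pole by a half turn\<close>

definition half_turn :: "real^3 \<Rightarrow> real^3" where
  "half_turn v = vector [- v$1, - v$2, v$3]"

lemma half_turn_nth [simp]:
  "half_turn v $ 1 = - v$1" "half_turn v $ 2 = - v$2" "half_turn v $ 3 = v$3"
  by (simp_all add: half_turn_def)

lemma linear_half_turn: "linear half_turn"
  by (rule linearI) (simp_all add: vec_eq_iff forall_3)

lemma mink_half_turn: "mink (half_turn a) (half_turn b) = mink a b"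
  by (simp add: mink_def)

lemma minkowski_rotation_half_turn: "minkowski_rotation half_turn"
  by (simp add: minkowski_rotation_def linear_half_turn mink_half_turn det_3 matrix_def axis_def)

lemma minkowski_rotation_id: "minkowski_rotation id"
  by (simp add: minkowski_rotation_def linear_id matrix_id)

text \<open>A linear isometry commutes with partial derivatives and preserves all fundamental form
  coefficients. Determinant one keeps the frame positively oriented.\<close>

lemma canonical_maximal_surface_half_turn:
  assumes "canonical_maximal_surface D z l"
  shows "canonical_maximal_surface D (half_turn \<circ> z) (half_turn \<circ> l)"
proof -
  interpret canonical_maximal_surface D z l by fact
  define z' where "z' = (\<lambda>q. half_turn (z q))"
  define l' where "l' = (\<lambda>q. half_turn (l q))"
  have bl: "bounded_linear half_turn"
    using linear_half_turn by (simp add: linear_linear)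
  have pd: "pdx z' p = half_turn (pdx z p)" "pdy z' p = half_turn (pdy z p)" if "p \<in> D" for p
    unfolding z'_def by (fact pd_linear[OF bl smooth_z that])+
  have pd2: "pdx (pdx z') p = half_turn (pdx (pdx z) p)" "pdy (pdx z') p = half_turn (pdy (pdx z) p)"
    "pdy (pdy z') p = half_turn (pdy (pdy z) p)" if "p \<in> D" for p
    unfolding z'_def by (fact pd2_linear[OF bl open_D smooth_z that])+
  have forms: "coefE z' p = coefE z p" "coefF z' p = coefF z p" "coefG z' p = coefG z p"
    "coefe z' l' p = coefe z l p" "coeff z' l' p = coeff z l p" "coefg z' l' p = coefg z l p"
    if "p \<in> D" for p
    by (simp_all add: coefE_def coefF_def coefG_def coefe_def coeff_def coefg_def pd pd2 that
        l'_def mink_half_turn)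
  have nu: "nu1 z' l' p = nu1 z l p" "nu2 z' l' p = nu2 z l p" if "p \<in> D" for p
    by (simp_all add: nu1_def nu2_def forms that)
  have smooth_G: "smooth_fun_on D (coefG z)"
    unfolding coefG_def[abs_def]
    by (rule smooth_fun_on_bilinear[OF bounded_bilinear_mink open_D smooth_pd_z(2) smooth_pd_z(2)])
  \<comment> \<open>The geodesic curvatures contain derivatives of \<open>E\<close> and
    \<open>G\<close>, so equality at the point alone does not suffice; agreement on the open set
    \<open>D\<close> is used.\<close>
  have gamma: "gamma1 z' p = gamma1 z p" "gamma2 z' p = gamma2 z p" if "p \<in> D" for p
    using pd_transform(2)[OF open_D that smooth_E, of "coefE z'"]
      pd_transform(1)[OF open_D that smooth_G, of "coefG z'"]
    by (simp_all add: gamma1_def gamma2_def forms that)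
  have det: "det (vector [frameX z' p, frameY z' p, l' p] :: real^3^3)
    = det (vector [frameX z p, frameY z p, l p] :: real^3^3)" if "p \<in> D" for p
    by (simp add: frameX_def frameY_def forms pd that l'_def det_3)
  have "spacelike_principal_surface D z' l'"
    using surface smooth_fun_on_linear[OF open_D bl smooth_z]
    unfolding spacelike_principal_surface_def
    by (simp add: forms nu det pd l'_def[symmetric])
      (simp add: z'_def l'_def mink_half_turn)
  moreover have "maximal_on D z' l'" "strongly_regular_on D z'" "canonical_parameters_on D z' l'"
    using maximal regular canonical
    by (simp_all add: maximal_on_def strongly_regular_on_def canonical_parameters_on_def nu gamma forms)
  ultimately show ?thesis
    unfolding canonical_maximal_surface_def by (simp add: z'_def l'_def comp_def)
qed

theorem theorem2:
  fixes D :: "(real \<times> real) set" and z l :: "real \<times> real \<Rightarrow> real^3"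
  assumes "spacelike_principal_surface D z l"
    and "maximal_on D z l"
    and "strongly_regular_on D z"
    and "canonical_parameters_on D z l"
  shows "(\<forall>p\<in>D. l p $ 1 \<noteq> 1 \<longrightarrow> representable_near D z p) \<and>
         D \<subseteq> closure {p\<in>D. l p $ 1 \<noteq> 1} \<and>
         (\<forall>p\<in>D. \<exists>A. minkowski_rotation A \<and> representable_near D (A \<circ> z) p)"
proof -
  interpret canonical_maximal_surface D z l
    using assms by unfold_locales
  have "\<exists>A. minkowski_rotation A \<and> representable_near D (A \<circ> z) p" if "p \<in> D" for p
  proof (cases "l p $ 1 = 1")
    case True
    then have "representable_near D (half_turn \<circ> z) p"
      using canonical_maximal_surface.representable[OF canonical_maximal_surface_half_turn
          [OF canonical_maximal_surface_axioms] that] by simp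
    then show ?thesis using minkowski_rotation_half_turn by blast
  next
    case False
    then have "representable_near D (id \<circ> z) p"
      using representable[OF that] by simp
    then show ?thesis using minkowski_rotation_id by blast
  qed
  then show ?thesis
    using representable dense_chart by blast
qed

end
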